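(* Let $S$ be a finite linearly ordered set, let $\mathscr{C}\subseteq 2^S\setminus\{\emptyset\}$ be a set of non-empty subsets of $S$, let $\Gamma$ be an (additively written) abelian group, and let $f:2^S\rightarrow\Gamma$ be a mapping such that for every $C\in\mathscr{C}$ and every $A\subseteq S$ with $A\supseteq C$, $$f(A)+f(A\setminus\{\max C\})=0.$$ Then, for any $\mathscr{B}\subseteq\{C\setminus\{\max C\} \mid C\in\mathscr{C}\}$, $$\sum_{A\subseteq S} f(A)=\sum_{\substack{A\subseteq S\\ \forall B\in\mathscr{B}:\, B\not\subseteq A}} f(A).$$
   Context: $2^S$ denotes the power set of $S$, and $\max C$ denotes the maximum element of $C$ with respect to the given linear order on $S$. *)

theory Defs
  imports Main
begin

end

theory Submission
  imports Defs
begin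

text \<open>
  The sets that the right-hand side leaves out, i.e. those containing some member of \<open>\<B>\<close>,
  cancel in pairs. Let \<open>A\<close> be such a set. Among all \<open>C \<in> \<C>\<close> with
  \<open>C - {Max C} \<in> \<B>\<close> and \<open>C - {Max C} \<subseteq> A\<close>, take the smallest value \<open>m\<close> of \<open>Max C\<close>,
  and pair \<open>A\<close> with the set obtained by toggling the membership of \<open>m\<close>.
  The hypothesis on \<open>f\<close> says that the two values of \<open>f\<close> in a pair add up to zero.

  What needs care is that both members of a pair yield the same \<open>m\<close>. Toggling \<open>m\<close> changes
  the truth of \<open>C - {Max C} \<subseteq> A\<close> only if \<open>m \<in> C - {Max C}\<close>, and then \<open>m < Max C\<close>; hence
  neither a witness for \<open>m\<close> is lost nor a smaller value is gained. This is the only place where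
  the linear order matters, and it is why the minimum of the values \<open>Max C\<close> is the right choice.
  The excluded sets are therefore partitioned by \<open>m\<close> into classes closed under toggling
  \<open>m\<close>, and the sum over each class vanishes (\<open>sum_toggle_eq_0\<close>).
\<close>

text \<open>
  Removing \<open>m\<close> is a bijection from the members of the family with \<open>m\<close> onto those without.
  Pairing the terms explicitly, rather than showing that the sum equals its own negative, keeps
  this true in groups with 2-torsion.
\<close>

lemma sum_toggle_eq_0:
  fixes f :: "'a set \<Rightarrow> 'g::ab_group_add"
  assumes "finite \<F>"
    and ins: "\<And>A. A \<in> \<F> \<Longrightarrow> insert m A \<in> \<F>"
    and del: "\<And>A. A \<in> \<F> \<Longrightarrow> A - {m} \<in> \<F>"
    and cancel: "\<And>A. A \<in> \<F> \<Longrightarrow> m \<in> A \<Longrightarrow> f A + f (A - {m}) = 0"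
  shows "sum f \<F> = 0"
proof -
  let ?with = "{A \<in> \<F>. m \<in> A}" and ?without = "{A \<in> \<F>. m \<notin> A}"
  have "sum f \<F> = sum f (?with \<union> ?without)"
    by (rule arg_cong[of _ _ "sum f"]) auto
  also have "\<dots> = sum f ?with + sum f ?without"
    using \<open>finite \<F>\<close> by (intro sum.union_disjoint) auto
  also have "sum f ?without = (\<Sum>A\<in>?with. f (A - {m}))"
    by (rule sum.reindex_bij_witness[where i = "\<lambda>A. A - {m}" and j = "insert m"])
      (use ins del in \<open>auto simp: insert_absorb\<close>)
  also have "sum f ?with + \<dots> = (\<Sum>A\<in>?with. f A + f (A - {m}))"
    by (rule sum.distrib[symmetric])
  also have "\<dots> = 0"
    using cancel by (intro sum.neutral) auto
  finally show ?thesis .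
qed

theorem theorem1:
  fixes S :: "'a::linorder set"
    and \<C> \<B> :: "'a set set"
    and f :: "'a set \<Rightarrow> 'g::ab_group_add"
  assumes "finite S"
    and "\<C> \<subseteq> Pow S - {{}}"
    and "\<And>C A. C \<in> \<C> \<Longrightarrow> A \<subseteq> S \<Longrightarrow> C \<subseteq> A \<Longrightarrow> f A + f (A - {Max C}) = 0"
    and "\<B> \<subseteq> {C - {Max C} | C. C \<in> \<C>}"
  shows "(\<Sum>A\<in>Pow S. f A) = (\<Sum>A\<in>{A \<in> Pow S. \<forall>B\<in>\<B>. \<not> B \<subseteq> A}. f A)"
proof -
  define M where "M A = {Max C | C. C \<in> \<C> \<and> C - {Max C} \<in> \<B> \<and> C - {Max C} \<subseteq> A}" for A
  define \<E> where "\<E> = {A \<in> Pow S. \<exists>B\<in>\<B>. B \<subseteq> A}"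
  have fin\<E>: "finite \<E>"
    using \<open>finite S\<close> by (simp add: \<E>_def)
  have C: "finite C" "C \<noteq> {}" "C \<subseteq> S" "Max C \<in> C" if "C \<in> \<C>" for C
    using that assms(2) \<open>finite S\<close> by (auto intro: finite_subset Max_in)
  have M_sub: "M A \<subseteq> S" for A
    using C(3,4) unfolding M_def by blast
  have finM: "finite (M A)" for A
    using M_sub \<open>finite S\<close> by (rule finite_subset)
  have \<E>_iff: "A \<in> \<E> \<longleftrightarrow> A \<subseteq> S \<and> M A \<noteq> {}" for A
    using assms(4) by (auto simp: \<E>_def M_def)
  \<comment> \<open>The minimum depends only on \<open>A\<close> outside of that minimum.\<close>
  have Min_eq: "A' \<in> \<E> \<and> Min (M A') = Min (M A)"
    if A: "A \<in> \<E>" and A': "A' \<subseteq> S" "A' - {Min (M A)} = A - {Min (M A)}" for A A'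
  proof -
    define m where "m = Min (M A)"
    have transfer: "x \<in> M Y" if x: "x \<in> M X" "x \<le> m" and XY: "X - {m} = Y - {m}" for x X Y
    proof -
      from x obtain D where D: "x = Max D" "D \<in> \<C>" "D - {Max D} \<in> \<B>" "D - {Max D} \<subseteq> X"
        by (auto simp: M_def)
      \<comment> \<open>Every element of \<open>D - {Max D}\<close> lies strictly below \<open>x \<le> m\<close>.\<close>
      have "m \<notin> D - {Max D}"
        using C(1)[OF D(2)] x(2) D(1) by (auto dest: Max_ge)
      then have "D - {Max D} \<subseteq> Y"
        using D(4) XY by blast
      then show ?thesis
        using D by (auto simp: M_def)
    qed
    have eq: "A' - {m} = A - {m}"
      using A'(2) by (simp add: m_def)
    have "m \<in> M A"
      using A finM unfolding m_def \<E>_iff by (intro Min_in) auto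
    then have m: "m \<in> M A'"
      using transfer eq by auto
    have "Min (M A') = m"
    proof (rule Min_eqI[OF finM _ m])
      fix y assume y: "y \<in> M A'"
      show "m \<le> y"
      proof (rule ccontr)
        assume "\<not> m \<le> y"
        with y have "y \<in> M A"
          using transfer eq by auto
        then have "m \<le> y"
          unfolding m_def using finM by simp
        with \<open>\<not> m \<le> y\<close> show False ..
      qed
    qed
    with m A'(1) show ?thesis
      by (auto simp: \<E>_iff m_def)
  qed
  have fibre: "sum f {A \<in> \<E>. Min (M A) = m} = 0" for m
  proof (rule sum_toggle_eq_0[where m = m])
    show "finite {A \<in> \<E>. Min (M A) = m}"
      using fin\<E> by simp
  next
    fix A assume "A \<in> {A \<in> \<E>. Min (M A) = m}"
    then have A: "A \<in> \<E>" "Min (M A) = m" "A \<subseteq> S"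
      by (auto simp: \<E>_iff)
    then have mM: "m \<in> M A"
      using Min_in[OF finM, of A] by (auto simp: \<E>_iff)
    then have "m \<in> S"
      using M_sub by auto
    then show "insert m A \<in> {A \<in> \<E>. Min (M A) = m}" "A - {m} \<in> {A \<in> \<E>. Min (M A) = m}"
      using A Min_eq[of A "insert m A"] Min_eq[of A "A - {m}"] by auto
    from mM obtain D where D: "m = Max D" "D \<in> \<C>" "D - {Max D} \<subseteq> A"
      by (auto simp: M_def)
    assume "m \<in> A"
    with D have "D \<subseteq> A"
      by auto
    with D(1,2) A(3) show "f A + f (A - {m}) = 0"
      using assms(3) by simp
  qed
  have "sum f \<E> = (\<Sum>m\<in>S. sum f {A \<in> \<E>. Min (M A) = m})"
  proof (rule sum.group[symmetric, OF fin\<E> \<open>finite S\<close>])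
    show "(\<lambda>A. Min (M A)) ` \<E> \<subseteq> S"
      using M_sub Min_in[OF finM] by (fastforce simp: \<E>_iff)
  qed
  then have "sum f \<E> = 0"
    by (simp add: fibre)
  moreover have "sum f (Pow S) = sum f (Pow S - \<E>) + sum f \<E>"
    using \<open>finite S\<close> by (intro sum.subset_diff) (auto simp: \<E>_def)
  moreover have "Pow S - \<E> = {A \<in> Pow S. \<forall>B\<in>\<B>. \<not> B \<subseteq> A}"
    by (auto simp: \<E>_def)
  ultimately show ?thesis
    by simp
qed

end
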